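(* Let $\theta$ be a feasible distribution on $\mathbb{R}_+$. Then $0$ belongs to the support of $\theta$.
   Context: Notation: $\mathbb{R}_+=[0,\infty[$; a distribution on $\mathbb{R}_+$ is a Borel probability measure on $\mathbb{R}_+$. A distribution $\theta$ on $\mathbb{R}_+$ is called feasible if there exist a complete separable metric space $(S,d)$ and a Borel probability measure $\mu$ on $S$ such that, for $\xi_1,\xi_2$ independent random variables with distribution $\mu$, the random variable $D=d(\xi_1,\xi_2)$ has distribution $\theta$. The support of $\theta$ contains $0$ if and only if $\theta[0,\varepsilon]>0$ for every $\varepsilon>0$. *)

theory Defs
  imports "HOL-Probability.Probability"
begin

definition borel_Rplus :: "real measure" where
  "borel_Rplus = restrict_space borel {0..}"

definition distribution_on_Rplus :: "real measure \<Rightarrow> bool" where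
  "distribution_on_Rplus \<theta> \<longleftrightarrow> prob_space \<theta> \<and> sets \<theta> = sets borel_Rplus"

definition metric_borel :: "'s metric \<Rightarrow> 's measure" where
  "metric_borel m = sigma (mspace m) {U. openin (mtopology_of m) U}"

definition complete_separable_metric :: "'s metric \<Rightarrow> bool" where
  "complete_separable_metric m \<longleftrightarrow> mcomplete_of m \<and> separable_space (mtopology_of m)"

text \<open>
  HOL cannot quantify over types inside a formula, so the type \<open>'s\<close> containing the carrier
  \<open>mspace m\<close> of the metric space and the type \<open>'w\<close> underlying the probability space \<open>M\<close> on which
  the random variables live are parameters. A theorem with the hypothesis
  \<open>feasible TYPE('s) TYPE('w) \<theta>\<close> for type variables \<open>'s\<close> and \<open>'w\<close> thus covers every choice of
  metric space and of probability space. The law of \<open>d(\<xi>1, \<xi>2)\<close> is determined by \<open>m\<close> and \<open>\<mu>\<close>, so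
  it is immaterial which independent pair with distribution \<open>\<mu>\<close> is taken.
\<close>

definition feasible :: "'s itself \<Rightarrow> 'w itself \<Rightarrow> real measure \<Rightarrow> bool" where
  "feasible _ _ \<theta> \<longleftrightarrow>
    (\<exists>(m :: 's metric) (\<mu> :: 's measure) (M :: 'w measure) \<xi>1 \<xi>2.
      complete_separable_metric m \<and>
      prob_space \<mu> \<and> sets \<mu> = sets (metric_borel m) \<and>
      prob_space M \<and>
      prob_space.indep_var M (metric_borel m) \<xi>1 (metric_borel m) \<xi>2 \<and>
      distr M (metric_borel m) \<xi>1 = \<mu> \<and>
      distr M (metric_borel m) \<xi>2 = \<mu> \<and>
      distr M borel_Rplus (\<lambda>\<omega>. mdist m (\<xi>1 \<omega>) (\<xi>2 \<omega>)) = \<theta>)"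

text \<open>
  The points of \<open>space \<theta>\<close> all of whose relatively open neighbourhoods have positive mass;
  for a distribution on the nonnegative reals, \<open>space \<theta> = {0..}\<close>.
\<close>

definition measure_support :: "real measure \<Rightarrow> real set" where
  "measure_support \<theta> =
    {x \<in> space \<theta>. \<forall>U. open U \<and> x \<in> U \<longrightarrow> 0 < emeasure \<theta> (U \<inter> space \<theta>)}"

lemma space_borel_Rplus [simp]: "space borel_Rplus = {0..}"
  by (simp add: borel_Rplus_def space_restrict_space)

lemma space_distribution_on_Rplus:
  "distribution_on_Rplus \<theta> \<Longrightarrow> space \<theta> = {0..}"
  unfolding distribution_on_Rplus_def by (metis sets_eq_imp_space_eq space_borel_Rplus)

lemma sets_borel_Rplus_iff: "A \<in> sets borel_Rplus \<longleftrightarrow> A \<in> sets borel \<and> A \<subseteq> {0..}"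
  by (auto simp: borel_Rplus_def sets_restrict_space_iff)

lemma zero_in_measure_support_iff:
  assumes "distribution_on_Rplus \<theta>"
  shows "0 \<in> measure_support \<theta> \<longleftrightarrow> (\<forall>\<epsilon>>0. 0 < emeasure \<theta> {0..\<epsilon>})"
proof -
  have sp: "space \<theta> = {0..}" and st: "\<And>A. A \<in> sets \<theta> \<longleftrightarrow> A \<in> sets borel \<and> A \<subseteq> {0..}"
    using assms space_distribution_on_Rplus
    by (auto simp: distribution_on_Rplus_def sets_borel_Rplus_iff)
  show ?thesis
  proof (intro iffI allI impI)
    fix \<epsilon> :: real
    assume L: "0 \<in> measure_support \<theta>" and "\<epsilon> > 0"
    then have "0 < emeasure \<theta> ({-\<epsilon><..<\<epsilon>} \<inter> {0..})"
      by (auto simp: measure_support_def sp)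
    also have "\<dots> \<le> emeasure \<theta> {0..\<epsilon>}"
      by (intro emeasure_mono) (auto simp: st)
    finally show "0 < emeasure \<theta> {0..\<epsilon>}" .
  next
    assume R: "\<forall>\<epsilon>>0. 0 < emeasure \<theta> {0..\<epsilon>}"
    have "0 < emeasure \<theta> (U \<inter> {0..})" if U: "open U" "0 \<in> U" for U
    proof -
      obtain e where e: "e > 0" "cball 0 e \<subseteq> U"
        using U open_contains_cball by blast
      have "{0..e} \<subseteq> U \<inter> {0..}"
        using e(2) by (auto simp: cball_def dist_real_def subset_iff)
      then have "emeasure \<theta> {0..e} \<le> emeasure \<theta> (U \<inter> {0..})"
        using U by (intro emeasure_mono) (auto simp: st)
      then show ?thesis
        using R e(1) by (meson less_le_trans)
    qed
    then show "0 \<in> measure_support \<theta>"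
      by (auto simp: measure_support_def sp)
  qed
qed

end

theory Submission
  imports Defs
begin

text \<open>
  A separable metric space is covered by countably many balls of any given radius \<open>r\<close>, so a
  probability measure \<open>\<mu>\<close> on it gives positive mass to one of them, \<open>B\<close> say. By independence both
  random points lie in \<open>B\<close> with probability \<open>\<mu>(B)\<^sup>2 > 0\<close>, and then their distance is below \<open>2 r\<close>.
  Hence the law of the distance charges every interval \<open>[0, \<epsilon>]\<close>; with \<open>r = \<epsilon>/2\<close> this is the claim.

  Transferring this event to the law \<open>\<theta>\<close> of the distance requires that the distance be a random
  variable. This is not automatic for two maps that are each measurable for the Borel sets of a
  metric space, since the Borel sets of the product need not be generated by measurable rectangles;
  it is separability that makes the distance measurable
  (\<open>measurable_mdist_of_separable\<close>).
\<close>

lemma space_metric_borel: "space (metric_borel m) = mspace m"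
  unfolding metric_borel_def by (intro space_measure_of) (use openin_subset in fastforce)

lemma sets_metric_borel_open:
  "openin (mtopology_of m) U \<Longrightarrow> U \<in> sets (metric_borel m)"
  unfolding metric_borel_def by (subst sets_measure_of) (use openin_subset in fastforce)+

lemma mball_of_in_sets_metric_borel: "mball_of m x r \<in> sets (metric_borel m)"
  by (intro sets_metric_borel_open)
     (simp add: mball_of_def mtopology_of_def Metric_space.openin_mball)

lemma measurable_mdist_of_point:
  assumes "q \<in> mspace m"
  shows "mdist m q \<in> borel_measurable (metric_borel m)"
  unfolding borel_measurable_iff_less
proof
  fix a
  have "{x \<in> space (metric_borel m). mdist m q x < a} = mball_of m q a"
    using assms by (auto simp: space_metric_borel)
  then show "{x \<in> space (metric_borel m). mdist m q x < a} \<in> sets (metric_borel m)"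
    by (simp add: mball_of_in_sets_metric_borel)
qed

lemma separable_space_imp_countable_net:
  assumes "separable_space (mtopology_of m)"
  obtains C where "countable C" "C \<subseteq> mspace m"
    "\<And>x r. x \<in> mspace m \<Longrightarrow> 0 < r \<Longrightarrow> \<exists>q\<in>C. mdist m q x < r"
proof -
  interpret Metric_space "mspace m" "mdist m" by (rule Metric_space_mspace_mdist)
  obtain C where C: "countable C" "C \<subseteq> mspace m" "mtopology closure_of C = mspace m"
    using assms unfolding separable_space_def by (auto simp: mtopology_of_def)
  then have "\<exists>q\<in>C. mdist m q x < r" if "x \<in> mspace m" "0 < r" for x r
    using that by (fastforce simp: metric_closure_of commute)
  with C that show thesis by blast
qed

text \<open>
  With a countable dense set \<open>C\<close> the distance is an infimum of countably many functions of a single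
  point each: \<open>d(x, y) < a\<close> if and only if \<open>d(q, x) + d(q, y) < a\<close> for some \<open>q\<close> in \<open>C\<close>.
\<close>

lemma measurable_mdist_of_separable:
  assumes sep: "separable_space (mtopology_of m)"
    and X [measurable]: "X \<in> measurable M (metric_borel m)"
    and Y [measurable]: "Y \<in> measurable M (metric_borel m)"
  shows "(\<lambda>w. mdist m (X w) (Y w)) \<in> borel_measurable M"
  unfolding borel_measurable_iff_less
proof
  fix a
  obtain C where C: "countable C" "C \<subseteq> mspace m"
    and dense: "\<And>x r. x \<in> mspace m \<Longrightarrow> 0 < r \<Longrightarrow> \<exists>q\<in>C. mdist m q x < r"
    using sep by (rule separable_space_imp_countable_net) blast
  have mem: "X w \<in> mspace m" "Y w \<in> mspace m" if "w \<in> space M" for w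
    using measurable_space[OF X that] measurable_space[OF Y that]
    by (simp_all add: space_metric_borel)
  have iff: "mdist m x y < a \<longleftrightarrow> (\<exists>q\<in>C. mdist m q x + mdist m q y < a)"
    if xy: "x \<in> mspace m" "y \<in> mspace m" for x y
  proof
    assume "mdist m x y < a"
    \<comment> \<open>Replacing \<open>x\<close> by \<open>q\<close> costs at most \<open>2 d(q, x)\<close>, so half of the slack suffices.\<close>
    then obtain q where q: "q \<in> C" "mdist m q x < (a - mdist m x y) / 2"
      using dense[OF xy(1), of "(a - mdist m x y) / 2"] by auto
    moreover have "mdist m q y \<le> mdist m q x + mdist m x y"
      using q C xy by (intro mdist_triangle) auto
    ultimately show "\<exists>q\<in>C. mdist m q x + mdist m q y < a"
      by (intro bexI[of _ q]) (simp_all add: field_simps)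
  next
    assume "\<exists>q\<in>C. mdist m q x + mdist m q y < a"
    then obtain q where q: "q \<in> C" "mdist m q x + mdist m q y < a" by blast
    moreover have "mdist m x y \<le> mdist m x q + mdist m q y"
      using q C xy by (intro mdist_triangle) auto
    ultimately show "mdist m x y < a" by (simp add: mdist_commute)
  qed
  have "{w \<in> space M. mdist m (X w) (Y w) < a} =
      (\<Union>q\<in>C. {w \<in> space M. mdist m q (X w) + mdist m q (Y w) < a})"
    using mem iff by auto
  also have "\<dots> \<in> sets M"
  proof (intro sets.countable_UN'' C(1))
    fix q assume "q \<in> C"
    then have [measurable]: "mdist m q \<in> borel_measurable (metric_borel m)"
      using C by (intro measurable_mdist_of_point) auto
    show "{w \<in> space M. mdist m q (X w) + mdist m q (Y w) < a} \<in> sets M"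
      by measurable
  qed
  finally show "{w \<in> space M. mdist m (X w) (Y w) < a} \<in> sets M" .
qed

text \<open>
  Otherwise the space would be a countable union of null sets, namely of the balls of radius \<open>r\<close>
  centred at the points of a countable dense set.
\<close>

lemma ex_ball_positive_measure:
  assumes sep: "separable_space (mtopology_of m)"
    and \<mu>: "prob_space \<mu>" "sets \<mu> = sets (metric_borel m)"
    and r: "0 < r"
  obtains q where "0 < measure \<mu> (mball_of m q r)"
proof -
  interpret prob_space \<mu> by fact
  obtain C where C: "countable C" "C \<subseteq> mspace m"
    and dense: "\<And>x r. x \<in> mspace m \<Longrightarrow> 0 < r \<Longrightarrow> \<exists>q\<in>C. mdist m q x < r"
    using sep by (rule separable_space_imp_countable_net) blast
  have space: "space \<mu> = mspace m"
    using sets_eq_imp_space_eq[OF \<mu>(2)] by (simp add: space_metric_borel)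
  have "\<exists>q. 0 < measure \<mu> (mball_of m q r)"
  proof (rule ccontr)
    assume "\<nexists>q. 0 < measure \<mu> (mball_of m q r)"
    then have "mball_of m q r \<in> null_sets \<mu>" for q
      using \<mu>(2) by (intro null_setsI)
        (simp_all add: emeasure_eq_measure mball_of_in_sets_metric_borel
          zero_less_measure_iff)
    then have "(\<Union>q\<in>C. mball_of m q r) \<in> null_sets \<mu>"
      using C(1) by (intro null_sets_UN') auto
    moreover have "(\<Union>q\<in>C. mball_of m q r) = space \<mu>"
      using C(2) dense r by (fastforce simp: space)
    ultimately show False
      by (simp add: null_sets_def emeasure_space_1)
  qed
  with that show thesis by blast
qed

theorem proposition1:
  fixes \<theta> :: "real measure"
  assumes "distribution_on_Rplus \<theta>"
    and "feasible TYPE('s) TYPE('w) \<theta>"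
  shows "0 \<in> measure_support \<theta>"
proof -
  obtain m :: "'s metric" and \<mu> and M :: "'w measure" and X Y where
    sep: "separable_space (mtopology_of m)" and
    \<mu>: "prob_space \<mu>" "sets \<mu> = sets (metric_borel m)" and
    M: "prob_space M" and
    ind: "prob_space.indep_var M (metric_borel m) X (metric_borel m) Y" and
    lawX: "distr M (metric_borel m) X = \<mu>" and
    lawY: "distr M (metric_borel m) Y = \<mu>" and
    law: "distr M borel_Rplus (\<lambda>w. mdist m (X w) (Y w)) = \<theta>"
    using assms(2) unfolding feasible_def complete_separable_metric_def by blast
  interpret prob_space M by fact
  have X [measurable]: "X \<in> measurable M (metric_borel m)"
    and Y [measurable]: "Y \<in> measurable M (metric_borel m)"
    using indep_var_rv1[OF ind] indep_var_rv2[OF ind] .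
  have D: "(\<lambda>w. mdist m (X w) (Y w)) \<in> measurable M borel_Rplus"
    unfolding borel_Rplus_def
    by (intro measurable_restrict_space2 measurable_mdist_of_separable[OF sep X Y]) auto
  have "0 < emeasure \<theta> {0..\<epsilon>}" if "0 < \<epsilon>" for \<epsilon> :: real
  proof -
    obtain q where q: "0 < measure \<mu> (mball_of m q (\<epsilon> / 2))"
      using ex_ball_positive_measure[OF sep \<mu>, of "\<epsilon> / 2"] \<open>0 < \<epsilon>\<close> by auto
    define B where "B = mball_of m q (\<epsilon> / 2)"
    have B: "B \<in> sets (metric_borel m)"
      unfolding B_def by (rule mball_of_in_sets_metric_borel)
    have I: "{0..\<epsilon>} \<in> sets borel_Rplus"
      by (simp add: sets_borel_Rplus_iff)
    have close: "mdist m x y \<le> \<epsilon>" if "x \<in> B" "y \<in> B" for x y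
    proof -
      have "mdist m x y \<le> mdist m x q + mdist m q y"
        using that by (intro mdist_triangle) (auto simp: B_def)
      then show ?thesis using that by (simp add: B_def mdist_commute)
    qed
    have "0 < measure \<mu> B * measure \<mu> B"
      using q by (simp add: B_def)
    also have "\<dots> = prob (X -` B \<inter> space M) * prob (Y -` B \<inter> space M)"
      using measure_distr[OF X B] measure_distr[OF Y B] by (simp add: lawX lawY)
    also have "\<dots> = prob ((\<lambda>w. (X w, Y w)) -` (B \<times> B) \<inter> space M)"
      by (rule indep_varD[OF ind B B, symmetric])
    also have "\<dots> \<le> prob ((\<lambda>w. mdist m (X w) (Y w)) -` {0..\<epsilon>} \<inter> space M)"
      using close by (intro finite_measure_mono measurable_sets[OF D I]) auto
    finally show ?thesis
      using emeasure_distr[OF D I] by (simp add: law emeasure_eq_measure)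
  qed
  then show ?thesis
    using zero_in_measure_support_iff[OF assms(1)] by blast
qed

end
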